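(* Let $\mathcal{H}$ be a finite-dimensional Hilbert space and $\mathbb{L}\subseteq\mathrm{Ef}(\mathcal{H})$ a finite sub-effect algebra. Let $c:X\to D_{\mathbb{L}}X$ and $d:Y\to D_{\mathbb{L}}Y$ be $D_{\mathbb{L}}$-coalgebras and $x\in X$, $y\in Y$. If for every density operator $\rho\in\mathrm{DM}(\mathcal{H})$, $x$ and $y$ are kernel bisimilar in the $D_{[0,1]}$-coalgebras $\downarrow_\rho(X,c)$ and $\downarrow_\rho(Y,d)$, then $x$ and $y$ are kernel bisimilar in $(X,c)$ and $(Y,d)$.
   Context: For $\mathcal{H}$ of dimension $n$, $\mathrm{Ef}(\mathcal{H})=\{L\in\mathbb{C}^{n\times n}:0\sqsubseteq L\sqsubseteq\mathbb{I}\}$ (Löwner order), an effect algebra with matrix sum (defined iff the sum is $\sqsubseteq\mathbb{I}$), zero matrix and complement $L'=\mathbb{I}-L$. A finite sub-effect algebra is a finite subset $\mathbb{L}$ containing $0$ and $\mathbb{I}$, closed under $L\mapsto\mathbb{I}-L$, which is an effect algebra under the matrix sum restricted to pairs whose sum lies in $\mathbb{L}$. $\mathrm{DM}(\mathcal{H})=\{\rho\in\mathbb{C}^{n\times n}:\rho\sqsupseteq0,\ \mathrm{tr}(\rho)=1\}$. The unit interval $[0,1]$ is an effect algebra with sum $+$ defined when $\le 1$ and $p'=1-p$. For an effect algebra $\mathbb{E}$ (partial sum $+$), $D_{\mathbb{E}}X$ is the set of finitely supported $\Delta:X\to\mathbb{E}$ whose sum over the support is defined, and $(D_{\mathbb{E}}f)(\Delta)(y)=\sum_{x\in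 f^{-1}(y)}\Delta(x)$. A $D_{\mathbb{E}}$-coalgebra is $(X,c)$ with $c:X\to D_{\mathbb{E}}X$; a homomorphism $f:(X,c)\to(Y,d)$ satisfies $D_{\mathbb{E}}f\circ c=d\circ f$. For $\rho\in\mathrm{DM}(\mathcal{H})$ let $m_\rho(L)=\mathrm{tr}(L\rho)$, and $\downarrow_\rho(X,c)=(X,c_\rho)$ with $c_\rho(x)=m_\rho\circ c(x)\in D_{[0,1]}X$. Kernel bisimilarity: a cocongruence between $(X,c)$ and $(Y,d)$ is a cospan of maps $X\xrightarrow{m_1}Z\xleftarrow{m_2}Y$ such that some coalgebra $(Z,e)$ makes $m_1,m_2$ homomorphisms; $x$ and $y$ are kernel bisimilar iff $m_1(x)=m_2(y)$ for some cocongruence. *)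

theory Defs
  imports
    "HOL-Library.FuncSet"
    "Jordan_Normal_Form.Matrix"
    "Jordan_Normal_Form.Schur_Decomposition"
begin

section \<open>Effect algebras\<close>

text \<open>The partial sum is an option-valued operation: \<open>None\<close> means that the sum is undefined.\<close>

record 'e ea =
  ea_carrier :: "'e set"
  ea_plus :: "'e \<Rightarrow> 'e \<Rightarrow> 'e option"
  ea_zero :: "'e"
  ea_compl :: "'e \<Rightarrow> 'e"

definition ea_one :: "('e, 'm) ea_scheme \<Rightarrow> 'e" where
  "ea_one E = ea_compl E (ea_zero E)"

locale effect_algebra =
  fixes E :: "('e, 'm) ea_scheme"
  assumes zero_closed: "ea_zero E \<in> ea_carrier E"
    and compl_closed: "a \<in> ea_carrier E \<Longrightarrow> ea_compl E a \<in> ea_carrier E"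
    and plus_closed: "ea_plus E a b = Some s \<Longrightarrow>
          a \<in> ea_carrier E \<and> b \<in> ea_carrier E \<and> s \<in> ea_carrier E"
    and plus_comm: "ea_plus E a b = Some s \<Longrightarrow> ea_plus E b a = Some s"
    and plus_assoc: "ea_plus E a b = Some s \<Longrightarrow> ea_plus E s c = Some t \<Longrightarrow>
          \<exists>r. ea_plus E b c = Some r \<and> ea_plus E a r = Some t"
    and plus_zero: "a \<in> ea_carrier E \<Longrightarrow> ea_plus E (ea_zero E) a = Some a"
    and compl_unique: "a \<in> ea_carrier E \<Longrightarrow> b \<in> ea_carrier E \<Longrightarrow>
          ea_plus E a b = Some (ea_one E) \<longleftrightarrow> b = ea_compl E a"
    and plus_one: "ea_plus E a (ea_one E) = Some s \<Longrightarrow> a = ea_zero E"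

text \<open>\<open>ea_has_sum E f S s\<close>: the sum of the finite family \<open>f\<close> over \<open>S\<close> is defined and equals \<open>s\<close>.
  In an effect algebra the order of summation is irrelevant, see \<open>ea_has_sum_unique\<close> below.\<close>

inductive ea_has_sum :: "('e, 'm) ea_scheme \<Rightarrow> ('x \<Rightarrow> 'e) \<Rightarrow> 'x set \<Rightarrow> 'e \<Rightarrow> bool"
  for E :: "('e, 'm) ea_scheme" and f :: "'x \<Rightarrow> 'e"
where
  ea_has_sum_empty: "ea_has_sum E f {} (ea_zero E)"
| ea_has_sum_insert: "ea_has_sum E f S s \<Longrightarrow> x \<notin> S \<Longrightarrow> ea_plus E (f x) s = Some t \<Longrightarrow>
    ea_has_sum E f (insert x S) t"

definition ea_sum :: "('e, 'm) ea_scheme \<Rightarrow> ('x \<Rightarrow> 'e) \<Rightarrow> 'x set \<Rightarrow> 'e" where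
  "ea_sum E f S = (THE s. ea_has_sum E f S s)"


section \<open>The functor \<open>D\<^sub>E\<close>, coalgebras and kernel bisimilarity\<close>

definition ea_supp :: "('e, 'm) ea_scheme \<Rightarrow> ('x \<Rightarrow> 'e) \<Rightarrow> 'x set" where
  "ea_supp E \<Delta> = {x. \<Delta> x \<noteq> ea_zero E}"

text \<open>A function on the carrier set \<open>X\<close> is represented by its extension with value \<open>ea_zero E\<close>
  outside \<open>X\<close>.\<close>

definition D_obj :: "('e, 'm) ea_scheme \<Rightarrow> 'x set \<Rightarrow> ('x \<Rightarrow> 'e) set" where
  "D_obj E X = {\<Delta>. range \<Delta> \<subseteq> ea_carrier E \<and> ea_supp E \<Delta> \<subseteq> X \<and> finite (ea_supp E \<Delta>) \<and>
                   (\<exists>s. ea_has_sum E \<Delta> (ea_supp E \<Delta>) s)}"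

definition D_map :: "('e, 'm) ea_scheme \<Rightarrow> ('x \<Rightarrow> 'y) \<Rightarrow> ('x \<Rightarrow> 'e) \<Rightarrow> 'y \<Rightarrow> 'e" where
  "D_map E f \<Delta> = (\<lambda>y. ea_sum E \<Delta> {x \<in> ea_supp E \<Delta>. f x = y})"

definition coalgebra :: "('e, 'm) ea_scheme \<Rightarrow> 'x set \<Rightarrow> ('x \<Rightarrow> 'x \<Rightarrow> 'e) \<Rightarrow> bool" where
  "coalgebra E X c \<longleftrightarrow> c \<in> X \<rightarrow> D_obj E X"

definition coalgebra_hom ::
  "('e, 'm) ea_scheme \<Rightarrow> 'x set \<Rightarrow> ('x \<Rightarrow> 'x \<Rightarrow> 'e) \<Rightarrow> 'y set \<Rightarrow> ('y \<Rightarrow> 'y \<Rightarrow> 'e) \<Rightarrow>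
    ('x \<Rightarrow> 'y) \<Rightarrow> bool" where
  "coalgebra_hom E X c Y d f \<longleftrightarrow> f \<in> X \<rightarrow> Y \<and> (\<forall>x\<in>X. D_map E f (c x) = d (f x))"

definition cocongruence ::
  "('e, 'm) ea_scheme \<Rightarrow> 'x set \<Rightarrow> ('x \<Rightarrow> 'x \<Rightarrow> 'e) \<Rightarrow> 'y set \<Rightarrow> ('y \<Rightarrow> 'y \<Rightarrow> 'e) \<Rightarrow>
    'z set \<Rightarrow> ('x \<Rightarrow> 'z) \<Rightarrow> ('y \<Rightarrow> 'z) \<Rightarrow> bool" where
  "cocongruence E X c Y d Z m1 m2 \<longleftrightarrow>
     (\<exists>e. coalgebra E Z e \<and> coalgebra_hom E X c Z e m1 \<and> coalgebra_hom E Y d Z e m2)"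

text \<open>HOL cannot quantify existentially over the type in which the apex \<open>Z\<close> of the cospan lives.
  Subsets of the disjoint union of the two state types suffice: by \<open>kernel_bisimilarI\<close> below, a
  cocongruence with apex in an arbitrary type yields one of this form.\<close>

definition kernel_bisimilar ::
  "('e, 'm) ea_scheme \<Rightarrow> 'x set \<Rightarrow> ('x \<Rightarrow> 'x \<Rightarrow> 'e) \<Rightarrow> 'y set \<Rightarrow> ('y \<Rightarrow> 'y \<Rightarrow> 'e) \<Rightarrow>
    'x \<Rightarrow> 'y \<Rightarrow> bool" where
  "kernel_bisimilar E X c Y d x y \<longleftrightarrow>
     (\<exists>(Z :: ('x + 'y) set) m1 m2. cocongruence E X c Y d Z m1 m2 \<and> m1 x = m2 y)"


section \<open>Effects, density operators and the induced probabilistic coalgebras\<close>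

definition psd :: "nat \<Rightarrow> complex mat \<Rightarrow> bool" where
  "psd n A \<longleftrightarrow> A \<in> carrier_mat n n \<and> mat_adjoint A = A \<and>
     (\<forall>v \<in> carrier_vec n. 0 \<le> (A *\<^sub>v v) \<bullet>c v)"

definition loewner_le :: "nat \<Rightarrow> complex mat \<Rightarrow> complex mat \<Rightarrow> bool" where
  "loewner_le n A B \<longleftrightarrow> A \<in> carrier_mat n n \<and> B \<in> carrier_mat n n \<and> psd n (B - A)"

definition mat_trace :: "complex mat \<Rightarrow> complex" where
  "mat_trace A = (\<Sum>i<dim_row A. A $$ (i, i))"

definition effects :: "nat \<Rightarrow> complex mat set" where
  "effects n = {A \<in> carrier_mat n n. loewner_le n (0\<^sub>m n n) A \<and> loewner_le n A (1\<^sub>m n)}"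

definition density_ops :: "nat \<Rightarrow> complex mat set" where
  "density_ops n = {\<rho> \<in> carrier_mat n n. loewner_le n (0\<^sub>m n n) \<rho> \<and> mat_trace \<rho> = 1}"

definition matrix_ea :: "nat \<Rightarrow> complex mat set \<Rightarrow> complex mat ea" where
  "matrix_ea n L =
     \<lparr>ea_carrier = L,
      ea_plus = (\<lambda>A B. if A \<in> L \<and> B \<in> L \<and> A + B \<in> L then Some (A + B) else None),
      ea_zero = 0\<^sub>m n n,
      ea_compl = (\<lambda>A. 1\<^sub>m n - A)\<rparr>"

definition finite_sub_effect_algebra :: "nat \<Rightarrow> complex mat set \<Rightarrow> bool" where
  "finite_sub_effect_algebra n L \<longleftrightarrow>
     finite L \<and> L \<subseteq> effects n \<and> 0\<^sub>m n n \<in> L \<and> 1\<^sub>m n \<in> L \<and> (\<forall>A\<in>L. 1\<^sub>m n - A \<in> L) \<and>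
     effect_algebra (matrix_ea n L)"

definition unit_interval_ea :: "real ea" where
  "unit_interval_ea =
     \<lparr>ea_carrier = {0..1},
      ea_plus = (\<lambda>p q. if p \<in> {0..1} \<and> q \<in> {0..1} \<and> p + q \<le> 1 then Some (p + q) else None),
      ea_zero = 0,
      ea_compl = (\<lambda>p. 1 - p)\<rparr>"

text \<open>For an effect \<open>L\<close> and a density operator \<open>\<rho>\<close> the trace of \<open>L * \<rho>\<close> is real, so taking the
  real part only changes the type.\<close>

definition born :: "complex mat \<Rightarrow> complex mat \<Rightarrow> real" where
  "born \<rho> L = Re (mat_trace (L * \<rho>))"

definition down_coalg :: "complex mat \<Rightarrow> ('x \<Rightarrow> 'x \<Rightarrow> complex mat) \<Rightarrow> 'x \<Rightarrow> 'x \<Rightarrow> real" where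
  "down_coalg \<rho> c x = born \<rho> \<circ> c x"


section \<open>Well-definedness of the encoding\<close>

lemma effect_algebra_unit_interval: "effect_algebra unit_interval_ea"
  by unfold_locales
    (auto simp: unit_interval_ea_def ea_one_def split: if_splits)

lemma ea_has_sum_empty_iff: "ea_has_sum E f {} s \<longleftrightarrow> s = ea_zero E"
  by (auto elim: ea_has_sum.cases intro: ea_has_sum.intros)

lemma (in effect_algebra) ea_has_sum_remove:
  assumes "ea_has_sum E f S s" "x \<in> S"
  shows "\<exists>t. ea_has_sum E f (S - {x}) t \<and> ea_plus E (f x) t = Some s"
  using assms
proof (induction rule: ea_has_sum.induct)
  case ea_has_sum_empty
  then show ?case by simp
next
  case (ea_has_sum_insert S s y t)
  show ?case
  proof (cases "x = y")
    case True
    then show ?thesis using ea_has_sum_insert by auto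
  next
    case False
    then obtain u where u: "ea_has_sum E f (S - {x}) u" "ea_plus E (f x) u = Some s"
      using ea_has_sum_insert by auto
    have "ea_plus E s (f y) = Some t"
      using ea_has_sum_insert.hyps(3) plus_comm by blast
    obtain r where r: "ea_plus E u (f y) = Some r" "ea_plus E (f x) r = Some t"
      using plus_assoc[OF u(2) \<open>ea_plus E s (f y) = Some t\<close>] by blast
    have "ea_has_sum E f (insert y (S - {x})) r"
      using ea_has_sum.ea_has_sum_insert[OF u(1)] ea_has_sum_insert.hyps(2) plus_comm[OF r(1)]
      by blast
    moreover have "insert y (S - {x}) = insert y S - {x}"
      using False by auto
    ultimately show ?thesis using r(2) by auto
  qed
qed

lemma (in effect_algebra) ea_has_sum_unique:
  assumes "ea_has_sum E f S s" "ea_has_sum E f S t"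
  shows "s = t"
  using assms
proof (induction arbitrary: t rule: ea_has_sum.induct)
  case ea_has_sum_empty
  then show ?case by (simp add: ea_has_sum_empty_iff)
next
  case (ea_has_sum_insert S s x t t')
  obtain u where u: "ea_has_sum E f (insert x S - {x}) u" "ea_plus E (f x) u = Some t'"
    using ea_has_sum_remove[OF ea_has_sum_insert.prems, of x] by auto
  have "insert x S - {x} = S" using ea_has_sum_insert.hyps by auto
  then have "s = u" using u(1) ea_has_sum_insert.IH by simp
  then show ?case using u(2) ea_has_sum_insert.hyps by simp
qed

lemma ea_has_sum_reindex:
  assumes "ea_has_sum E f S s" "inj_on g S" "\<And>x. x \<in> S \<Longrightarrow> f' (g x) = f x"
  shows "ea_has_sum E f' (g ` S) s"
  using assms
proof (induction rule: ea_has_sum.induct)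
  case ea_has_sum_empty
  then show ?case by (auto intro: ea_has_sum.intros)
next
  case (ea_has_sum_insert S s x t)
  then have "ea_has_sum E f' (g ` S) s" by auto
  moreover have "g x \<notin> g ` S" using ea_has_sum_insert by auto
  moreover have "ea_plus E (f' (g x)) s = Some t" using ea_has_sum_insert by auto
  ultimately show ?case using ea_has_sum.ea_has_sum_insert by fastforce
qed

lemma D_map_outside:
  assumes "\<And>x. x \<in> ea_supp E \<Delta> \<Longrightarrow> f x \<noteq> y"
  shows "D_map E f \<Delta> y = ea_zero E"
proof -
  have "{x \<in> ea_supp E \<Delta>. f x = y} = {}" using assms by auto
  moreover have "ea_sum E \<Delta> {} = ea_zero E"
    by (simp add: ea_sum_def ea_has_sum_empty_iff)
  ultimately show ?thesis
    by (simp only: D_map_def)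
qed

lemma D_map_comp_inj:
  assumes "inj_on g U" "f ` ea_supp E \<Delta> \<subseteq> U" "z \<in> U"
  shows "D_map E (g \<circ> f) \<Delta> (g z) = D_map E f \<Delta> z"
proof -
  have "{x \<in> ea_supp E \<Delta>. (g \<circ> f) x = g z} = {x \<in> ea_supp E \<Delta>. f x = z}"
    using assms by (auto dest: inj_onD)
  then show ?thesis by (simp add: D_map_def)
qed

lemma coalgebra_hom_transport:
  assumes B: "coalgebra E B b" "coalgebra_hom E B b Z e m" "m ` B \<subseteq> U"
    and inj: "inj_on g U"
    and hg: "\<And>z. z \<in> U \<Longrightarrow> h (g z) = z"
    and e'_def: "\<And>w v. e' w v = (if v \<in> g ` U then e (h w) (h v) else ea_zero E)"
  shows "coalgebra_hom E B b (g ` U) e' (g \<circ> m)"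
  unfolding coalgebra_hom_def
proof (intro conjI ballI)
  show "g \<circ> m \<in> B \<rightarrow> g ` U" using B(3) by auto
  fix a assume a: "a \<in> B"
  have supp: "ea_supp E (b a) \<subseteq> B" using B(1) a by (auto simp: coalgebra_def D_obj_def)
  show "D_map E (g \<circ> m) (b a) = e' ((g \<circ> m) a)"
  proof
    fix v
    show "D_map E (g \<circ> m) (b a) v = e' ((g \<circ> m) a) v"
    proof (cases "v \<in> g ` U")
      case True
      then obtain u where u: "u \<in> U" "v = g u" by auto
      have "D_map E (g \<circ> m) (b a) v = D_map E m (b a) u"
        unfolding u(2) by (rule D_map_comp_inj[OF inj]) (use supp B(3) u in auto)
      also have "\<dots> = e (m a) u" using B(2) a by (simp add: coalgebra_hom_def)
      also have "\<dots> = e' ((g \<circ> m) a) v"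
        using u a B(3) hg by (auto simp: e'_def image_subset_iff)
      finally show ?thesis .
    next
      case False
      then have "D_map E (g \<circ> m) (b a) v = ea_zero E"
        by (intro D_map_outside) (use supp B(3) in auto)
      then show ?thesis using False by (simp add: e'_def)
    qed
  qed
qed

lemma ea_supp_D_map:
  assumes "coalgebra E B b" "a \<in> B"
  shows "ea_supp E (D_map E m (b a)) \<subseteq> m ` B"
proof
  fix w assume "w \<in> ea_supp E (D_map E m (b a))"
  then obtain s where "s \<in> ea_supp E (b a)" "m s = w"
    using D_map_outside[of E "b a" m w] by (auto simp: ea_supp_def)
  moreover have "ea_supp E (b a) \<subseteq> B"
    using assms by (auto simp: coalgebra_def D_obj_def)
  ultimately show "w \<in> m ` B" by auto
qed

lemma (in effect_algebra) kernel_bisimilarI: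
  fixes Z :: "'z set" and X :: "'x set" and Y :: "'y set"
  assumes c: "coalgebra E X c" and d: "coalgebra E Y d"
    and cc: "cocongruence E X c Y d Z m1 m2"
    and x: "x \<in> X" and y: "y \<in> Y" and xy: "m1 x = m2 y"
  shows "kernel_bisimilar E X c Y d x y"
proof -
  obtain e where e: "coalgebra E Z e" and h1: "coalgebra_hom E X c Z e m1"
    and h2: "coalgebra_hom E Y d Z e m2"
    using cc unfolding cocongruence_def by auto
  define U where "U = m1 ` X \<union> m2 ` Y"
  have UZ: "U \<subseteq> Z" using h1 h2 by (auto simp: U_def coalgebra_hom_def)
  define g :: "'z \<Rightarrow> 'x + 'y" where
    "g z = (if z \<in> m1 ` X then Inl (inv_into X m1 z) else Inr (inv_into Y m2 z))" for z
  have inj: "inj_on g U"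
  proof (rule inj_onI)
    fix z z' assume zz: "z \<in> U" "z' \<in> U" "g z = g z'"
    show "z = z'"
    proof (cases "z \<in> m1 ` X")
      case True
      then have "z' \<in> m1 ` X" using zz by (auto simp: g_def split: if_splits)
      then show ?thesis using True zz by (auto simp: g_def dest: inv_into_injective)
    next
      case False
      then have "z' \<notin> m1 ` X" using zz by (auto simp: g_def split: if_splits)
      then have "z \<in> m2 ` Y" "z' \<in> m2 ` Y" "inv_into Y m2 z = inv_into Y m2 z'"
        using False zz by (auto simp: g_def U_def)
      then show ?thesis by (metis f_inv_into_f)
    qed
  qed
  define h where "h = inv_into U g"
  have hg: "h (g z) = z" if "z \<in> U" for z
    using that inj by (simp add: h_def)
  define e' where "e' w v = (if v \<in> g ` U then e (h w) (h v) else ea_zero E)" for w v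
  have supp_e: "ea_supp E (e z) \<subseteq> U" if z: "z \<in> U" for z
  proof -
    consider a where "a \<in> X" "z = m1 a" | b where "b \<in> Y" "z = m2 b"
      using z by (auto simp: U_def)
    then show ?thesis
    proof cases
      case 1
      then have "e z = D_map E m1 (c a)" using h1 by (auto simp: coalgebra_hom_def)
      then show ?thesis using ea_supp_D_map[OF c 1(1), of m1] by (auto simp: U_def)
    next
      case 2
      then have "e z = D_map E m2 (d b)" using h2 by (auto simp: coalgebra_hom_def)
      then show ?thesis using ea_supp_D_map[OF d 2(1), of m2] by (auto simp: U_def)
    qed
  qed
  have coalg': "coalgebra E (g ` U) e'"
    unfolding coalgebra_def
  proof
    fix w assume "w \<in> g ` U"
    then obtain z where z: "z \<in> U" "w = g z" by auto
    have ez: "e z \<in> D_obj E Z" using e z UZ by (auto simp: coalgebra_def)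
    have val: "e' w (g u) = e z u" if "u \<in> U" for u
      using that z hg by (simp add: e'_def)
    have out: "e' w v = ea_zero E" if "v \<notin> g ` U" for v
      using that by (simp add: e'_def)
    have supp: "ea_supp E (e' w) = g ` ea_supp E (e z)"
    proof
      show "ea_supp E (e' w) \<subseteq> g ` ea_supp E (e z)"
      proof
        fix v assume v: "v \<in> ea_supp E (e' w)"
        then have "v \<in> g ` U" using out by (auto simp: ea_supp_def)
        then show "v \<in> g ` ea_supp E (e z)" using v val by (auto simp: ea_supp_def)
      qed
      show "g ` ea_supp E (e z) \<subseteq> ea_supp E (e' w)"
        using supp_e[OF z(1)] val by (auto simp: ea_supp_def)
    qed
    obtain s where s: "ea_has_sum E (e z) (ea_supp E (e z)) s"
      using ez by (auto simp: D_obj_def)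
    have "ea_has_sum E (e' w) (g ` ea_supp E (e z)) s"
      using s supp_e[OF z(1)]
      by (intro ea_has_sum_reindex[OF s]) (auto intro: inj_on_subset[OF inj] simp: val subset_iff)
    moreover have "range (e' w) \<subseteq> ea_carrier E"
    proof -
      have r: "range (e z) \<subseteq> ea_carrier E" using ez by (simp add: D_obj_def)
      have "e' w v \<in> ea_carrier E" for v
        using r val out[of v] zero_closed by (cases "v \<in> g ` U") auto
      then show ?thesis by auto
    qed
    ultimately show "e' w \<in> D_obj E (g ` U)"
      using supp supp_e[OF z(1)] ez by (auto simp: D_obj_def)
  qed
  have "coalgebra_hom E X c (g ` U) e' (g \<circ> m1)" "coalgebra_hom E Y d (g ` U) e' (g \<circ> m2)"
    using coalgebra_hom_transport[OF c h1 _ inj hg e'_def] coalgebra_hom_transport[OF d h2 _ inj hg e'_def]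
    by (auto simp: U_def)
  then have "cocongruence E X c Y d (g ` U) (g \<circ> m1) (g \<circ> m2)"
    using coalg' unfolding cocongruence_def by blast
  moreover have "(g \<circ> m1) x = (g \<circ> m2) y" using xy by simp
  ultimately show ?thesis unfolding kernel_bisimilar_def by blast
qed

end

theory Submission
  imports Defs
begin

text \<open>A finite set \<open>L\<close> of effects is separated by a single density operator: the difference of two
  distinct effects is Hermitian and nonzero, so by polarization it has a nonzero expectation in some
  pure state, and a state that works for finitely many differences can be mixed with one that works
  for another, since each difference excludes at most one mixing weight. For this \<open>\<rho>\<close> the map
  \<open>born \<rho>\<close> is an embedding of effect algebras, and a cocongruence for the probabilistic coalgebras
  pulls back along it, because every sum occurring in a pushforward already lies in \<open>L\<close>.\<close>

section \<open>Embeddings of effect algebras reflect kernel bisimilarity\<close>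

context effect_algebra
begin

lemma ea_has_sum_finite: "ea_has_sum E f S s \<Longrightarrow> finite S"
  by (induction rule: ea_has_sum.induct) auto

lemma ea_has_sum_closed: "ea_has_sum E f S s \<Longrightarrow> s \<in> ea_carrier E"
  by (induction rule: ea_has_sum.induct) (auto intro: zero_closed dest: plus_closed)

lemma ea_sum_eqI: "ea_has_sum E f S s \<Longrightarrow> ea_sum E f S = s"
  unfolding ea_sum_def by (blast intro: ea_has_sum_unique the_equality)

text \<open>The axiom re-brackets to the right; commuting the summands before and after applying it
  gives the other direction.\<close>

lemma plus_assoc':
  assumes "ea_plus E b c = Some r" "ea_plus E a r = Some t"
  shows "\<exists>s. ea_plus E a b = Some s \<and> ea_plus E s c = Some t"
  by (meson assms plus_assoc plus_comm)

text \<open>The elements of \<open>A\<close> are pulled out of the sum one at a time and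
  re-bracketed to the left. There is no converse: both partial sums may exist while their sum is
  undefined.\<close>

lemma ea_has_sum_Un_split:
  assumes "finite A" "ea_has_sum E f (A \<union> B) s" "A \<inter> B = {}"
  shows "\<exists>a b. ea_has_sum E f A a \<and> ea_has_sum E f B b \<and> ea_plus E a b = Some s"
  using assms
proof (induction A arbitrary: s rule: finite_induct)
  case empty
  then show ?case
    by (auto intro!: ea_has_sum_empty plus_zero ea_has_sum_closed)
next
  case (insert x A)
  have eq: "insert x A \<union> B - {x} = A \<union> B"
    using insert by auto
  obtain t where t: "ea_has_sum E f (A \<union> B) t" "ea_plus E (f x) t = Some s"
    using ea_has_sum_remove[OF insert.prems(1), of x] unfolding eq by auto
  obtain a b where ab: "ea_has_sum E f A a" "ea_has_sum E f B b" "ea_plus E a b = Some t"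
    using insert.IH[OF t(1)] insert.prems(2) by auto
  obtain r where "ea_plus E (f x) a = Some r" "ea_plus E r b = Some s"
    using plus_assoc'[OF ab(3) t(2)] by blast
  then show ?case
    using ab insert.hyps by (blast intro: ea_has_sum_insert)
qed

text \<open>Makes the \<open>THE\<close> in \<open>ea_sum\<close> denote an actual sum on every part
  of a summable set, in particular on the fibres that occur in \<open>D_map\<close>.\<close>

lemma ea_has_sum_subset:
  assumes "ea_has_sum E f S s" "T \<subseteq> S"
  shows "ea_has_sum E f T (ea_sum E f T)"
proof -
  have "finite T"
    using assms ea_has_sum_finite finite_subset by blast
  moreover have "T \<union> (S - T) = S"
    using assms by auto
  ultimately obtain a where "ea_has_sum E f T a"
    using ea_has_sum_Un_split[of T f "S - T" s] assms by auto
  then show ?thesis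
    using ea_sum_eqI by blast
qed

text \<open>Grouping by fibres yields a sum indexed by the image of the support, whereas
  \<open>D_obj\<close> asks for one indexed by the support of the pushforward. The two index sets
  differ by zero summands.\<close>

lemma ea_has_sum_drop_zero:
  "ea_has_sum E f S s \<Longrightarrow> ea_has_sum E f {x \<in> S. f x \<noteq> ea_zero E} s"
proof (induction rule: ea_has_sum.induct)
  case ea_has_sum_empty
  then show ?case by (simp add: ea_has_sum.ea_has_sum_empty)
next
  case (ea_has_sum_insert S s x t)
  show ?case
  proof (cases "f x = ea_zero E")
    case True
    then have "t = s"
      using ea_has_sum_insert plus_zero ea_has_sum_closed by fastforce
    moreover have "{y \<in> insert x S. f y \<noteq> ea_zero E} = {y \<in> S. f y \<noteq> ea_zero E}"
      using True by auto
    ultimately show ?thesis using ea_has_sum_insert.IH by simp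
  next
    case False
    then have "{y \<in> insert x S. f y \<noteq> ea_zero E} = insert x {y \<in> S. f y \<noteq> ea_zero E}"
      by auto
    then show ?thesis
      using ea_has_sum.ea_has_sum_insert[OF ea_has_sum_insert.IH _ ea_has_sum_insert.hyps(3)]
        ea_has_sum_insert.hyps(2) by simp
  qed
qed

text \<open>General associativity, by induction on the image of \<open>g\<close>: each step splits
  one fibre \<open>A\<close> off the sum and leaves the rest \<open>B\<close> to the induction
  hypothesis.\<close>

lemma ea_has_sum_fibres:
  assumes "ea_has_sum E f S s"
  shows "ea_has_sum E (\<lambda>z. ea_sum E f {x \<in> S. g x = z}) (g ` S) s"
proof -
  have "finite (g ` S)"
    using ea_has_sum_finite[OF assms] by simp
  then show ?thesis
    using assms
  proof (induction "g ` S" arbitrary: S s rule: finite_induct)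
    case empty
    then show ?case by (simp add: ea_has_sum_empty_iff)
  next
    case (insert z T)
    define A where "A = {x \<in> S. g x = z}"
    define B where "B = {x \<in> S. g x \<noteq> z}"
    have T: "T = g ` B"
      using insert.hyps(2,4) by (auto simp: B_def)
    have "A \<union> B = S" "A \<inter> B = {}"
      by (auto simp: A_def B_def)
    then obtain a b where ab: "ea_has_sum E f A a" "ea_has_sum E f B b" "ea_plus E a b = Some s"
      using ea_has_sum_Un_split[of A f B s] insert.prems ea_has_sum_finite[OF insert.prems] by auto
    have "ea_has_sum E (\<lambda>w. ea_sum E f {x \<in> S. g x = w}) T b"
    proof -
      have "ea_has_sum E (\<lambda>w. ea_sum E f {x \<in> B. g x = w}) T b"
        using insert.hyps(3)[OF T ab(2)] T by simp
      moreover have "{x \<in> S. g x = w} = {x \<in> B. g x = w}" if "w \<in> T" for w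
        using that insert.hyps(2) by (auto simp: B_def)
      \<comment> \<open>Reindexing along the identity serves as a congruence rule: it exchanges
        summands that agree on \<open>T\<close>.\<close>
      ultimately show ?thesis
        using ea_has_sum_reindex[of E _ T b "\<lambda>w. w"] by simp
    qed
    moreover have "ea_plus E (ea_sum E f {x \<in> S. g x = z}) b = Some s"
      using ab ea_sum_eqI[OF ab(1)] by (simp add: A_def)
    ultimately show ?case
      unfolding insert.hyps(4)[symmetric] using insert.hyps(2) by (blast intro: ea_has_sum_insert)
  qed
qed

lemma D_map_has_sum:
  assumes "\<Delta> \<in> D_obj E X"
  shows "ea_has_sum E \<Delta> {x \<in> ea_supp E \<Delta>. f x = y} (D_map E f \<Delta> y)"
  using assms unfolding D_obj_def D_map_def by (auto intro: ea_has_sum_subset)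

text \<open>The pushforward vanishes off the image of the support, and grouping by fibres shows that
  its total is the total of \<open>\<Delta>\<close>.\<close>

lemma D_map_in_D_obj:
  assumes "\<Delta> \<in> D_obj E X" "f \<in> X \<rightarrow> Z"
  shows "D_map E f \<Delta> \<in> D_obj E Z"
proof -
  have img: "ea_supp E (D_map E f \<Delta>) \<subseteq> f ` ea_supp E \<Delta>"
  proof
    fix y assume "y \<in> ea_supp E (D_map E f \<Delta>)"
    then have "D_map E f \<Delta> y \<noteq> ea_zero E"
      by (simp add: ea_supp_def)
    then show "y \<in> f ` ea_supp E \<Delta>"
      using D_map_outside[of E \<Delta> f y] by blast
  qed
  obtain s where "ea_has_sum E \<Delta> (ea_supp E \<Delta>) s"
    using assms by (auto simp: D_obj_def)
  from ea_has_sum_drop_zero[OF ea_has_sum_fibres[OF this, of f]]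
  have "ea_has_sum E (D_map E f \<Delta>) {y \<in> f ` ea_supp E \<Delta>. D_map E f \<Delta> y \<noteq> ea_zero E} s"
    by (simp add: D_map_def)
  also have "{y \<in> f ` ea_supp E \<Delta>. D_map E f \<Delta> y \<noteq> ea_zero E} = ea_supp E (D_map E f \<Delta>)"
    using img by (auto simp: ea_supp_def)
  finally have sum: "ea_has_sum E (D_map E f \<Delta>) (ea_supp E (D_map E f \<Delta>)) s" .
  have "ea_supp E \<Delta> \<subseteq> X"
    using assms by (simp add: D_obj_def)
  then have "ea_supp E (D_map E f \<Delta>) \<subseteq> Z"
    using img assms(2) by blast
  moreover have "range (D_map E f \<Delta>) \<subseteq> ea_carrier E"
    using ea_has_sum_closed[OF D_map_has_sum[OF assms(1), of f]] by (simp add: image_subset_iff)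
  ultimately show ?thesis
    using sum ea_has_sum_finite[OF sum] unfolding D_obj_def by blast
qed

end

text \<open>The total of a distribution has to be defined but may differ from
  \<open>ea_one E\<close>, so the zero function is a legitimate default for a structure map.\<close>

lemma zero_in_D_obj:
  assumes "effect_algebra E"
  shows "(\<lambda>_. ea_zero E) \<in> D_obj E Z"
proof -
  interpret effect_algebra E by fact
  show ?thesis
    using zero_closed ea_has_sum_empty[of E "\<lambda>_. ea_zero E"]
    by (auto simp: D_obj_def ea_supp_def)
qed

section \<open>Embeddings of effect algebras\<close>

text \<open>Definedness of sums is preserved but need not be reflected: two members of a sub-effect
  algebra may add up to an effect outside it, while their expectations still have a sum in the unit
  interval.\<close>

locale effect_algebra_embedding = E: effect_algebra E + F: effect_algebra F
  for E :: "('e, 'm) ea_scheme" and F :: "('f, 'n) ea_scheme" +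
  fixes \<phi> :: "'e \<Rightarrow> 'f"
  assumes map_zero: "\<phi> (ea_zero E) = ea_zero F"
    and map_plus: "ea_plus E a b = Some s \<Longrightarrow> ea_plus F (\<phi> a) (\<phi> b) = Some (\<phi> s)"
    and inj_map: "inj_on \<phi> (ea_carrier E)"
begin

lemma ea_has_sum_map: "ea_has_sum E f S s \<Longrightarrow> ea_has_sum F (\<phi> \<circ> f) S (\<phi> s)"
  by (induction rule: ea_has_sum.induct)
    (auto simp: map_zero intro!: ea_has_sum_empty intro: ea_has_sum_insert map_plus)

lemma ea_supp_map:
  assumes "range \<Delta> \<subseteq> ea_carrier E"
  shows "ea_supp F (\<phi> \<circ> \<Delta>) = ea_supp E \<Delta>"
proof -
  have "\<phi> (\<Delta> x) = ea_zero F \<longleftrightarrow> \<Delta> x = ea_zero E" for x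
  proof -
    have "\<Delta> x \<in> ea_carrier E"
      using assms by auto
    then show ?thesis
      using inj_on_eq_iff[OF inj_map _ E.zero_closed] map_zero by metis
  qed
  then show ?thesis
    by (simp add: ea_supp_def)
qed

text \<open>Naturality of composition with \<open>\<phi>\<close>. Injectivity keeps the support, so
  both sides sum over the same fibre, and that sum already exists in \<open>E\<close>, from where
  \<open>\<phi>\<close> transports it.\<close>

lemma D_map_map:
  assumes "\<Delta> \<in> D_obj E X"
  shows "D_map F f (\<phi> \<circ> \<Delta>) = \<phi> \<circ> D_map E f \<Delta>"
proof
  fix y
  have supp: "ea_supp F (\<phi> \<circ> \<Delta>) = ea_supp E \<Delta>"
    using assms by (intro ea_supp_map) (simp add: D_obj_def)
  show "D_map F f (\<phi> \<circ> \<Delta>) y = (\<phi> \<circ> D_map E f \<Delta>) y"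
    using F.ea_sum_eqI[OF ea_has_sum_map[OF E.D_map_has_sum[OF assms, of f y]]]
    by (simp add: D_map_def[of F] supp)
qed

text \<open>At a state \<open>m a\<close> the homomorphism law and naturality force all values of
  \<open>e\<close> into the image of the carrier under \<open>\<phi>\<close>, where
  \<open>inv_into\<close> is a genuine inverse.\<close>

lemma D_map_pullback:
  assumes b: "coalgebra E B b" and m: "coalgebra_hom F B (\<lambda>x. \<phi> \<circ> b x) Z e m" and a: "a \<in> B"
  shows "D_map E m (b a) \<in> D_obj E Z"
    and "inv_into (ea_carrier E) \<phi> \<circ> e (m a) = D_map E m (b a)"
proof -
  have obj: "b a \<in> D_obj E B"
    using b a by (auto simp: coalgebra_def)
  then show D: "D_map E m (b a) \<in> D_obj E Z"
    using m by (intro E.D_map_in_D_obj) (auto simp: coalgebra_hom_def)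
  have "e (m a) = \<phi> \<circ> D_map E m (b a)"
    using m a D_map_map[OF obj, of m] by (auto simp: coalgebra_hom_def)
  then show "inv_into (ea_carrier E) \<phi> \<circ> e (m a) = D_map E m (b a)"
    using D by (auto simp: D_obj_def fun_eq_iff inv_into_f_f[OF inj_map] image_subset_iff)
qed

text \<open>The apex and its legs are kept; only the structure map is pulled back along \<open>\<phi>\<close>. On the
  images of the legs it takes values \<open>\<phi> \<circ> D_map E m \<Delta>\<close>, so there the pullback is unique.\<close>

lemma cocongruence_reflect:
  assumes c: "coalgebra E X c" and d: "coalgebra E Y d"
    and cc: "cocongruence F X (\<lambda>x. \<phi> \<circ> c x) Y (\<lambda>y. \<phi> \<circ> d y) Z m1 m2"
  shows "cocongruence E X c Y d Z m1 m2"
proof -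
  obtain e where m1: "coalgebra_hom F X (\<lambda>x. \<phi> \<circ> c x) Z e m1"
    and m2: "coalgebra_hom F Y (\<lambda>y. \<phi> \<circ> d y) Z e m2"
    using cc by (auto simp: cocongruence_def)
  \<comment> \<open>Off the images of the legs, \<open>e\<close> may take values that
    \<open>\<phi>\<close> does not attain. No homomorphism law constrains those states, so they
    receive the zero distribution.\<close>
  define e' where "e' z = (if z \<in> m1 ` X \<union> m2 ` Y then inv_into (ea_carrier E) \<phi> \<circ> e z
    else (\<lambda>_. ea_zero E))" for z
  have "coalgebra E Z e'"
    unfolding coalgebra_def
  proof
    fix z
    show "e' z \<in> D_obj E Z"
      using D_map_pullback[OF c m1] D_map_pullback[OF d m2] zero_in_D_obj[OF E.effect_algebra_axioms]
      by (auto simp: e'_def)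
  qed
  moreover have "coalgebra_hom E X c Z e' m1" "coalgebra_hom E Y d Z e' m2"
    using m1 m2 D_map_pullback(2)[OF c m1] D_map_pullback(2)[OF d m2]
    by (auto simp: coalgebra_hom_def e'_def)
  ultimately show ?thesis
    by (auto simp: cocongruence_def)
qed

lemma kernel_bisimilar_reflect:
  assumes "coalgebra E X c" "coalgebra E Y d"
    and "kernel_bisimilar F X (\<lambda>x. \<phi> \<circ> c x) Y (\<lambda>y. \<phi> \<circ> d y) x y"
  shows "kernel_bisimilar E X c Y d x y"
  using assms cocongruence_reflect unfolding kernel_bisimilar_def by blast

end

section \<open>The one-element effect algebra\<close>

lemma coalgebra_hom_trivial:
  assumes b: "coalgebra E B b" and triv: "ea_carrier E = {ea_zero E}"
  shows "coalgebra_hom E B b {z} (\<lambda>_ _. ea_zero E) (\<lambda>_. z)"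
proof -
  have "D_map E (\<lambda>_. z) (b a) = (\<lambda>_. ea_zero E)" if "a \<in> B" for a
  proof
    have "range (b a) \<subseteq> {ea_zero E}"
      using b that triv by (auto simp: coalgebra_def D_obj_def)
    then show "D_map E (\<lambda>_. z) (b a) w = ea_zero E" for w
      by (intro D_map_outside) (auto simp: ea_supp_def)
  qed
  then show ?thesis
    by (simp add: coalgebra_hom_def)
qed

text \<open>Zero is the only distribution here, so the one-point coalgebra is final and identifies
  all states.\<close>

lemma kernel_bisimilar_trivial:
  fixes X :: "'x set" and Y :: "'y set"
  assumes E: "effect_algebra E" and triv: "ea_carrier E = {ea_zero E}"
    and c: "coalgebra E X c" and d: "coalgebra E Y d"
  shows "kernel_bisimilar E X c Y d x y"
proof -
  \<comment> \<open>Any element of the sum type can serve as the single point of the apex.\<close>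
  define z :: "'x + 'y" where "z = Inl x"
  have Z: "coalgebra E {z} (\<lambda>_ _. ea_zero E)"
    using zero_in_D_obj[OF E] by (auto simp: coalgebra_def)
  have "cocongruence E X c Y d {z} (\<lambda>_. z) (\<lambda>_. z)"
    using Z coalgebra_hom_trivial[OF c triv, of z] coalgebra_hom_trivial[OF d triv, of z]
    unfolding cocongruence_def by blast
  then show ?thesis
    unfolding kernel_bisimilar_def by (intro exI conjI) (assumption, rule refl)
qed


section \<open>A density operator separating finitely many effects\<close>

lemma quadratic_form_expand:
  fixes A :: "complex mat"
  assumes "A \<in> carrier_mat n n" "v \<in> carrier_vec n"
  shows "(A *\<^sub>v v) \<bullet>c v = (\<Sum>i<n. \<Sum>j<n. A $$ (i, j) * v $ j * cnj (v $ i))"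
  using assms by (auto simp: scalar_prod_def sum_distrib_right lessThan_atLeast0 intro!: sum.cong)

lemma mat_trace_mult:
  assumes "A \<in> carrier_mat n n" "B \<in> carrier_mat n n"
  shows "mat_trace (A * B) = (\<Sum>i<n. \<Sum>j<n. A $$ (i, j) * B $$ (j, i))"
  using assms by (auto simp: mat_trace_def scalar_prod_def lessThan_atLeast0 intro!: sum.cong)

lemma mat_adjoint_eq_self_iff:
  fixes A :: "complex mat"
  assumes "A \<in> carrier_mat n n"
  shows "mat_adjoint A = A \<longleftrightarrow> (\<forall>i<n. \<forall>j<n. cnj (A $$ (i, j)) = A $$ (j, i))"
proof -
  have dim: "mat_adjoint A \<in> carrier_mat n n"
    using assms by (auto simp: mat_adjoint_def mat_of_rows_def)
  have ent: "mat_adjoint A $$ (i, j) = cnj (A $$ (j, i))" if "i < n" "j < n" for i j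
    using assms that by (auto simp: mat_adjoint_def mat_of_rows_def)
  show ?thesis
  proof
    assume *: "mat_adjoint A = A"
    have "cnj (A $$ (i, j)) = A $$ (j, i)" if "i < n" "j < n" for i j
      unfolding ent[OF that(2,1), symmetric] * ..
    then show "\<forall>i<n. \<forall>j<n. cnj (A $$ (i, j)) = A $$ (j, i)"
      by blast
  next
    assume *: "\<forall>i<n. \<forall>j<n. cnj (A $$ (i, j)) = A $$ (j, i)"
    show "mat_adjoint A = A"
      by (rule eq_matI) (use assms dim ent * in auto)
  qed
qed

lemma psd_carrier: "psd n A \<Longrightarrow> A \<in> carrier_mat n n"
  by (simp add: psd_def)

lemma psd_iff:
  "psd n A \<longleftrightarrow> A \<in> carrier_mat n n \<and> (\<forall>i<n. \<forall>j<n. cnj (A $$ (i, j)) = A $$ (j, i)) \<and>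
     (\<forall>v \<in> carrier_vec n. 0 \<le> (\<Sum>i<n. \<Sum>j<n. A $$ (i, j) * v $ j * cnj (v $ i)))"
  unfolding psd_def using mat_adjoint_eq_self_iff[of A n] quadratic_form_expand[of A n] by auto

lemma loewner_le_zero_iff: "loewner_le n (0\<^sub>m n n) A \<longleftrightarrow> psd n A"
proof -
  have "A - 0\<^sub>m n n = A" if "A \<in> carrier_mat n n"
    using that by auto
  then show ?thesis
    by (auto simp: loewner_le_def psd_def)
qed

lemma density_ops_iff: "\<rho> \<in> density_ops n \<longleftrightarrow> psd n \<rho> \<and> mat_trace \<rho> = 1"
  by (auto simp: density_ops_def loewner_le_zero_iff psd_def)

lemma effects_iff: "A \<in> effects n \<longleftrightarrow> psd n A \<and> psd n (1\<^sub>m n - A)"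
  using psd_carrier[of n A] by (auto simp: effects_def loewner_le_zero_iff loewner_le_def[of n A])

lemma born_add:
  assumes "A \<in> carrier_mat n n" "B \<in> carrier_mat n n" "\<rho> \<in> carrier_mat n n"
  shows "born \<rho> (A + B) = born \<rho> A + born \<rho> B"
  using assms by (simp add: born_def mat_trace_mult[of _ n] distrib_right sum.distrib)

lemma born_diff:
  assumes "A \<in> carrier_mat n n" "B \<in> carrier_mat n n" "\<rho> \<in> carrier_mat n n"
  shows "born \<rho> (A - B) = born \<rho> A - born \<rho> B"
  using assms by (simp add: born_def mat_trace_mult[of _ n] minus_carrier_mat left_diff_distrib
      sum_subtractf)

lemma born_one:
  assumes "\<rho> \<in> density_ops n"
  shows "born \<rho> (1\<^sub>m n) = 1"
  using assms left_mult_one_mat[of \<rho> n n] by (simp add: born_def density_ops_def)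

lemma born_zero:
  assumes "\<rho> \<in> carrier_mat n n"
  shows "born \<rho> (0\<^sub>m n n) = 0"
  using assms by (simp add: born_def mat_trace_def)

section \<open>Mixtures of density operators\<close>

definition mix :: "real \<Rightarrow> complex mat \<Rightarrow> complex mat \<Rightarrow> complex mat" where
  "mix t \<rho> \<sigma> = complex_of_real t \<cdot>\<^sub>m \<rho> + complex_of_real (1 - t) \<cdot>\<^sub>m \<sigma>"

lemma mix_carrier:
  "\<rho> \<in> carrier_mat n n \<Longrightarrow> \<sigma> \<in> carrier_mat n n \<Longrightarrow> mix t \<rho> \<sigma> \<in> carrier_mat n n"
  by (simp add: mix_def)

lemma mix_index:
  assumes "\<rho> \<in> carrier_mat n n" "\<sigma> \<in> carrier_mat n n" "i < n" "j < n"
  shows "mix t \<rho> \<sigma> $$ (i, j) = of_real t * \<rho> $$ (i, j) + of_real (1 - t) * \<sigma> $$ (i, j)"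
  using assms by (simp add: mix_def)

lemma born_mix:
  assumes "A \<in> carrier_mat n n" "\<rho> \<in> carrier_mat n n" "\<sigma> \<in> carrier_mat n n"
  shows "born (mix t \<rho> \<sigma>) A = t * born \<rho> A + (1 - t) * born \<sigma> A"
proof -
  have "mat_trace (A * mix t \<rho> \<sigma>) =
      of_real t * mat_trace (A * \<rho>) + of_real (1 - t) * mat_trace (A * \<sigma>)"
    unfolding mat_trace_mult[OF assms(1,2)] mat_trace_mult[OF assms(1,3)]
      mat_trace_mult[OF assms(1) mix_carrier[OF assms(2,3)]] sum_distrib_left sum.distrib[symmetric]
    by (intro sum.cong refl)
      (simp add: mix_index[OF assms(2,3)] distrib_left mult.left_commute del: of_real_diff)
  then show ?thesis
    by (simp add: born_def del: of_real_diff)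
qed

lemma mix_density:
  assumes "\<rho> \<in> density_ops n" "\<sigma> \<in> density_ops n" "t \<in> {0..1}"
  shows "mix t \<rho> \<sigma> \<in> density_ops n"
proof -
  have car: "\<rho> \<in> carrier_mat n n" "\<sigma> \<in> carrier_mat n n"
    using assms by (auto simp: density_ops_def)
  have "(\<Sum>i<n. \<Sum>j<n. mix t \<rho> \<sigma> $$ (i, j) * v $ j * cnj (v $ i)) =
      of_real t * (\<Sum>i<n. \<Sum>j<n. \<rho> $$ (i, j) * v $ j * cnj (v $ i)) +
      of_real (1 - t) * (\<Sum>i<n. \<Sum>j<n. \<sigma> $$ (i, j) * v $ j * cnj (v $ i))" for v :: "complex vec"
    unfolding sum_distrib_left sum.distrib[symmetric]
    by (intro sum.cong refl) (simp add: mix_index[OF car] distrib_right mult.assoc del: of_real_diff)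
  moreover have "0 \<le> complex_of_real t" "0 \<le> complex_of_real (1 - t)"
    using assms(3) by (simp_all add: less_eq_complex_def)
  ultimately have "psd n (mix t \<rho> \<sigma>)"
    using assms car by (auto simp: density_ops_iff psd_iff mix_carrier mix_index
        intro!: add_nonneg_nonneg mult_nonneg_nonneg)
  moreover have "mat_trace (mix t \<rho> \<sigma>) = of_real t * mat_trace \<rho> + of_real (1 - t) * mat_trace \<sigma>"
    using car carrier_matD(1)[OF mix_carrier[OF car]]
    by (simp add: mat_trace_def mix_index sum_distrib_left sum.distrib del: of_real_diff)
  ultimately show ?thesis
    using assms by (simp add: density_ops_iff)
qed

section \<open>Pure states and polarization\<close>

text \<open>For nonzero \<open>v\<close> this is the orthogonal projection onto the line through
  \<open>v\<close>. Dividing by the squared norm gives trace one without normalizing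
  \<open>v\<close>.\<close>

definition pure_state :: "nat \<Rightarrow> complex vec \<Rightarrow> complex mat" where
  "pure_state n v = mat n n (\<lambda>(i, j). v $ i * cnj (v $ j) / of_real (\<Sum>k<n. (cmod (v $ k))\<^sup>2))"

lemma pure_state_carrier: "pure_state n v \<in> carrier_mat n n"
  by (simp add: pure_state_def)

lemma pure_state_density:
  assumes "v \<in> carrier_vec n" "v \<noteq> 0\<^sub>v n"
  shows "pure_state n v \<in> density_ops n"
proof -
  define N where "N = (\<Sum>k<n. (cmod (v $ k))\<^sup>2)"
  obtain i where "i < n" "v $ i \<noteq> 0"
    using assms by (metis carrier_vecD eq_vecI index_zero_vec)
  then have N: "N > 0"
    unfolding N_def by (intro sum_pos2[of _ i]) auto
  have ent: "pure_state n v $$ (i, j) = v $ i * cnj (v $ j) / of_real N" if "i < n" "j < n" for i j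
    using that by (simp add: pure_state_def N_def)
  \<comment> \<open>The double sum factors into an inner product times its conjugate, which gives
    positivity.\<close>
  have "(\<Sum>i<n. \<Sum>j<n. pure_state n v $$ (i, j) * w $ j * cnj (w $ i)) =
      of_real ((cmod (\<Sum>i<n. v $ i * cnj (w $ i)))\<^sup>2 / N)" (is "?l = _") for w :: "complex vec"
  proof -
    have "?l = (\<Sum>i<n. v $ i * cnj (w $ i)) * cnj (\<Sum>i<n. v $ i * cnj (w $ i)) / of_real N"
      by (simp add: ent sum_product sum_divide_distrib mult_ac)
    then show ?thesis
      by (simp only: of_real_divide complex_norm_square)
  qed
  then have "0 \<le> (\<Sum>i<n. \<Sum>j<n. pure_state n v $$ (i, j) * w $ j * cnj (w $ i))"
    for w :: "complex vec"
    using N by (simp add: less_eq_complex_def)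
  then have "psd n (pure_state n v)"
    using ent by (simp add: psd_iff pure_state_carrier)
  moreover have "mat_trace (pure_state n v) = (\<Sum>i<n. of_real ((cmod (v $ i))\<^sup>2)) / of_real N"
    using pure_state_carrier[of n v]
    by (simp add: mat_trace_def ent sum_divide_distrib complex_norm_square del: of_real_power)
  then have "mat_trace (pure_state n v) = 1"
    unfolding of_real_sum[symmetric] N_def[symmetric] using N by simp
  ultimately show ?thesis
    by (simp add: density_ops_iff)
qed

text \<open>In coordinates, the trace of \<open>A\<close> times the rank-one matrix of
  \<open>v\<close> is the quadratic form of \<open>A\<close> at \<open>v\<close>, so the expectation
  is a Rayleigh quotient. This turns statements about forms into statements about states.\<close>

lemma born_pure_state:
  assumes "A \<in> carrier_mat n n" "v \<in> carrier_vec n"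
  shows "born (pure_state n v) A = Re ((A *\<^sub>v v) \<bullet>c v) / (\<Sum>k<n. (cmod (v $ k))\<^sup>2)"
proof -
  have "mat_trace (A * pure_state n v) = ((A *\<^sub>v v) \<bullet>c v) / of_real (\<Sum>k<n. (cmod (v $ k))\<^sup>2)"
    using assms pure_state_carrier[of n v]
    by (simp add: mat_trace_mult[of _ n] quadratic_form_expand pure_state_def sum_divide_distrib mult_ac
        del: of_real_sum)
  then show ?thesis
    by (simp add: born_def del: of_real_sum)
qed

text \<open>Polarization: the vectors \<open>e\<^sub>i\<close>, \<open>e\<^sub>i + e\<^sub>j\<close> and \<open>e\<^sub>i + \<i> e\<^sub>j\<close> recover the entries.\<close>

lemma hermitian_zero_if_form_zero:
  fixes A :: "complex mat"
  assumes A: "A \<in> carrier_mat n n"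
    and herm: "\<And>i j. i < n \<Longrightarrow> j < n \<Longrightarrow> cnj (A $$ (i, j)) = A $$ (j, i)"
    and form: "\<And>v. v \<in> carrier_vec n \<Longrightarrow> Re ((A *\<^sub>v v) \<bullet>c v) = 0"
  shows "A = 0\<^sub>m n n"
proof -
  have cnj_delta: "cnj (if P then z else 0) = (if P then cnj z else 0)" for P z
    by simp
  have delta: "(\<Sum>k<n. f k * (if k = i then z else 0)) = f i * z" if "i < n"
    for f :: "nat \<Rightarrow> complex" and i z
    using that by (simp add: if_distrib cong: if_cong)
  have two: "Re (A $$ (i, i) * (a * cnj a) + A $$ (i, j) * (b * cnj a) + A $$ (j, i) * (a * cnj b) +
      A $$ (j, j) * (b * cnj b)) = 0" if "i < n" "j < n" for i j a b
  proof -
    \<comment> \<open>Adding two conditionals also covers \<open>i = j\<close>, which is used with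
      \<open>b = 0\<close> to read off the diagonal.\<close>
    define v where "v = vec n (\<lambda>k. (if k = i then a else 0) + (if k = j then b else 0))"
    have "(A *\<^sub>v v) \<bullet>c v = (\<Sum>k<n. (A $$ (k, i) * a + A $$ (k, j) * b) *
        ((if k = i then cnj a else 0) + (if k = j then cnj b else 0)))"
      using that A
      by (simp add: quadratic_form_expand[of A n] v_def distrib_left sum.distrib delta cnj_delta
          flip: sum_distrib_right)
    also have "\<dots> = A $$ (i, i) * (a * cnj a) + A $$ (i, j) * (b * cnj a) + A $$ (j, i) * (a * cnj b) +
      A $$ (j, j) * (b * cnj b)"
      using that by (simp add: distrib_left[of "_ + _"] sum.distrib delta) (simp add: algebra_simps)
    finally show ?thesis
      using form[of v] by (simp add: v_def)
  qed
  have "A $$ (i, j) = 0" if ij: "i < n" "j < n" for i j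
  proof -
    have diag: "Re (A $$ (k, k)) = 0" if "k < n" for k
      using two[OF that that, of 1 0] by simp
    \<comment> \<open>The diagonal terms have real part 0. By Hermitian symmetry, coefficients 1, 1
      leave twice the real part of the entry, and 1, \<open>\<i>\<close> leave minus twice its
      imaginary part.\<close>
    have "Re (A $$ (i, j)) = 0"
      using two[OF ij, of 1 1] diag ij herm[OF ij, symmetric] by simp
    moreover have "Im (A $$ (i, j)) = 0"
      using two[OF ij, of 1 \<i>] diag ij herm[OF ij, symmetric] by simp
    ultimately show ?thesis
      by (simp add: complex_eq_iff)
  qed
  then show ?thesis
    using A by (intro eq_matI) auto
qed

text \<open>The defining condition holds for every density operator, but for mixtures of pure states it
  is immediate, so that no spectral decomposition is needed.\<close>

definition positive_states :: "nat \<Rightarrow> complex mat set" where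
  "positive_states n = {\<rho> \<in> density_ops n. \<forall>A. psd n A \<longrightarrow> 0 \<le> born \<rho> A}"

section \<open>Separation of finitely many effects by one state\<close>

text \<open>An affine function of \<open>t\<close> with value \<open>q\<close> at 0 and
  \<open>p\<close> at 1 has at most one root unless it vanishes identically. Applied to
  expectations, it limits the mixing weights that a given matrix excludes.\<close>

lemma finite_affine_roots:
  fixes p q :: real
  assumes "p \<noteq> 0 \<or> q \<noteq> 0"
  shows "finite {t. t * p + (1 - t) * q = 0}"
proof (rule finite_subset)
  show "{t. t * p + (1 - t) * q = 0} \<subseteq> {q / (q - p)}"
  proof
    fix t assume "t \<in> {t. t * p + (1 - t) * q = 0}"
    then have *: "t * (q - p) = q"
      by (simp add: algebra_simps)
    then have "q - p \<noteq> 0"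
      using assms by auto
    then show "t \<in> {q / (q - p)}"
      using * by (simp add: field_simps)
  qed
qed simp


lemma positive_states_mix:
  assumes "\<rho> \<in> positive_states n" "\<sigma> \<in> positive_states n" "t \<in> {0..1}"
  shows "mix t \<rho> \<sigma> \<in> positive_states n"
proof -
  have car: "\<rho> \<in> carrier_mat n n" "\<sigma> \<in> carrier_mat n n"
    using assms by (auto simp: positive_states_def density_ops_def)
  have "0 \<le> born (mix t \<rho> \<sigma>) A" if "psd n A" for A
  proof -
    have "A \<in> carrier_mat n n"
      using that by (simp add: psd_def)
    then show ?thesis
      using assms that by (simp add: born_mix[OF _ car] positive_states_def)
  qed
  then show ?thesis
    using assms mix_density by (simp add: positive_states_def)
qed

lemma pure_state_positive:
  assumes "v \<in> carrier_vec n" "v \<noteq> 0\<^sub>v n"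
  shows "pure_state n v \<in> positive_states n"
proof -
  have "0 \<le> born (pure_state n v) A" if "psd n A" for A
  proof -
    have "A \<in> carrier_mat n n" "0 \<le> Re ((A *\<^sub>v v) \<bullet>c v)"
      using that assms(1) by (simp_all add: psd_def less_eq_complex_def)
    then show ?thesis
      using assms(1) by (simp add: born_pure_state sum_nonneg)
  qed
  then show ?thesis
    using pure_state_density[OF assms] by (simp add: positive_states_def)
qed

lemma separating_state_exists:
  assumes "n \<noteq> 0" "finite F"
    and "\<And>A. A \<in> F \<Longrightarrow> A \<in> carrier_mat n n \<and> mat_adjoint A = A \<and> A \<noteq> 0\<^sub>m n n"
  shows "\<exists>\<rho>\<in>positive_states n. \<forall>A\<in>F. born \<rho> A \<noteq> 0"
  using assms(2,3)
proof (induction F rule: finite_induct)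
  case empty
  \<comment> \<open>For empty \<open>F\<close> any state will do; a nonzero vector exists because
    the dimension is positive.\<close>
  have "unit_vec n 0 \<noteq> (0\<^sub>v n :: complex vec)"
    using assms(1) by (metis index_unit_vec(1) index_zero_vec(1) neq0_conv zero_neq_one)
  then show ?case
    using pure_state_positive[of "unit_vec n 0" n] by auto
next
  case (insert A F)
  have A: "A \<in> carrier_mat n n" "mat_adjoint A = A" "A \<noteq> 0\<^sub>m n n"
    using insert.prems by auto
  obtain \<rho> where \<rho>: "\<rho> \<in> positive_states n" "\<forall>B\<in>F. born \<rho> B \<noteq> 0"
    using insert by auto
  obtain v where v: "v \<in> carrier_vec n" "Re ((A *\<^sub>v v) \<bullet>c v) \<noteq> 0"
    using hermitian_zero_if_form_zero[OF A(1)] A mat_adjoint_eq_self_iff[OF A(1)] by metis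
  have "v \<noteq> 0\<^sub>v n"
    using v A(1) by (auto simp: quadratic_form_expand)
  then obtain i where "i < n" "v $ i \<noteq> 0"
    using v(1) by (metis carrier_vecD eq_vecI index_zero_vec)
  then have "(\<Sum>k<n. (cmod (v $ k))\<^sup>2) > 0"
    by (intro sum_pos2[of _ i]) auto
  then have nz: "born (pure_state n v) A \<noteq> 0"
    using v by (simp add: born_pure_state[OF A(1) v(1)])
  have \<sigma>: "pure_state n v \<in> positive_states n"
    using pure_state_positive v(1) \<open>v \<noteq> 0\<^sub>v n\<close> by blast
  \<comment> \<open>The weights at which the mixture fails to see some matrix. Each condition is a
    nontrivial affine equation: \<open>\<rho>\<close> sees every member of \<open>F\<close>, and the
    pure state sees \<open>A\<close>.\<close>
  define bad where
    "bad = (\<Union>B\<in>insert A F. {t. t * born \<rho> B + (1 - t) * born (pure_state n v) B = 0})"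
  have "finite bad"
    unfolding bad_def using insert.hyps(1) \<rho>(2) nz
    by (intro finite_UN_I finite_affine_roots) auto
  moreover have "infinite {0..1 :: real}"
    by (rule infinite_Icc) simp
  ultimately obtain t where t: "t \<in> {0..1}" "t \<notin> bad"
    by (meson finite_subset subsetI)
  have "\<rho> \<in> carrier_mat n n"
    using \<rho>(1) by (simp add: positive_states_def density_ops_def)
  then have "born (mix t \<rho> (pure_state n v)) B \<noteq> 0" if "B \<in> insert A F" for B
    using that t(2) insert.prems[OF that] by (auto simp: bad_def born_mix pure_state_carrier)
  then show ?case
    using positive_states_mix[OF \<rho>(1) \<sigma> t(1)] by blast
qed

text \<open>Expectation is additive, so injectivity on \<open>L\<close> means that no difference of
  distinct members has expectation 0. These differences form a finite set of nonzero Hermitian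
  matrices.\<close>

lemma born_inj_on_finite:
  assumes "n \<noteq> 0" "finite L" "L \<subseteq> effects n"
  shows "\<exists>\<rho>\<in>positive_states n. inj_on (born \<rho>) L"
proof -
  define F where "F = (\<Union>A\<in>L. (\<lambda>B. A - B) ` (L - {A}))"
  have eff: "A \<in> carrier_mat n n" "mat_adjoint A = A" if "A \<in> L" for A
    using that assms(3) by (auto simp: effects_iff psd_def)
  have "C \<in> carrier_mat n n \<and> mat_adjoint C = C \<and> C \<noteq> 0\<^sub>m n n" if C_in: "C \<in> F" for C
  proof -
    obtain A B where AB: "A \<in> L" "B \<in> L" "A \<noteq> B" and C: "C = A - B"
      using C_in unfolding F_def by blast
    note car = eff(1)[OF AB(1)] eff(1)[OF AB(2)]
    have "C \<in> carrier_mat n n"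
      using car by (simp add: C minus_carrier_mat)
    moreover have "mat_adjoint C = C"
      using eff(2)[OF AB(1)] eff(2)[OF AB(2)] car
      unfolding C mat_adjoint_eq_self_iff[OF car(1)] mat_adjoint_eq_self_iff[OF car(2)]
        mat_adjoint_eq_self_iff[OF minus_carrier_mat[OF car(2)]]
      by simp
    moreover have "C \<noteq> 0\<^sub>m n n"
    proof
      assume zero: "C = 0\<^sub>m n n"
      have "A $$ (i, j) - B $$ (i, j) = 0" if "i < n" "j < n" for i j
        using arg_cong[OF zero, of "\<lambda>M. M $$ (i, j)"] car that by (simp add: C)
      then have "A = B"
        using car by (intro eq_matI) auto
      then show False using AB(3) by simp
    qed
    ultimately show ?thesis by blast
  qed
  moreover have "finite F"
    using assms(2) by (simp add: F_def)
  ultimately obtain \<rho> where \<rho>: "\<rho> \<in> positive_states n" "\<forall>C\<in>F. born \<rho> C \<noteq> 0"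
    using separating_state_exists[OF assms(1)] by blast
  have "\<rho> \<in> carrier_mat n n"
    using \<rho>(1) by (simp add: positive_states_def density_ops_def)
  have "inj_on (born \<rho>) L"
  proof (rule inj_onI, rule ccontr)
    fix A B assume AB: "A \<in> L" "B \<in> L" "born \<rho> A = born \<rho> B" "A \<noteq> B"
    then have "born \<rho> (A - B) \<noteq> 0"
      using \<rho>(2) by (auto simp: F_def)
    then show False
      using AB eff(1) \<open>\<rho> \<in> carrier_mat n n\<close> by (simp add: born_diff[of _ n])
  qed
  then show ?thesis
    using \<rho>(1) by blast
qed

text \<open>The upper bound is positivity applied to the complement, whose expectation is one minus
  that of \<open>A\<close>.\<close>

lemma born_in_unit_interval:
  assumes "\<rho> \<in> positive_states n" "A \<in> effects n"
  shows "born \<rho> A \<in> {0..1}"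
proof -
  have \<rho>: "\<rho> \<in> density_ops n" "\<rho> \<in> carrier_mat n n"
    using assms(1) by (auto simp: positive_states_def density_ops_def)
  have A: "psd n A" "psd n (1\<^sub>m n - A)" "A \<in> carrier_mat n n"
    using assms(2) by (auto simp: effects_iff psd_def)
  have "0 \<le> born \<rho> A" "0 \<le> born \<rho> (1\<^sub>m n - A)"
    using assms(1) A by (auto simp: positive_states_def)
  then show ?thesis
    using \<rho> A(3) by (simp add: born_diff[of _ n] born_one)
qed


section \<open>Reduction to probabilistic kernel bisimilarity\<close>

text \<open>A sum defined in \<open>matrix_ea n L\<close> is again a member of \<open>L\<close>,
  hence an effect with expectation at most 1; this makes the sum of expectations defined in the unit
  interval.\<close>

lemma born_embedding:
  assumes L: "finite_sub_effect_algebra n L"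
    and \<rho>: "\<rho> \<in> positive_states n" and inj: "inj_on (born \<rho>) L"
  shows "effect_algebra_embedding (matrix_ea n L) unit_interval_ea (born \<rho>)"
proof -
  interpret E: effect_algebra "matrix_ea n L"
    using L by (simp add: finite_sub_effect_algebra_def)
  interpret F: effect_algebra unit_interval_ea
    by (rule effect_algebra_unit_interval)
  have eff: "L \<subseteq> effects n"
    using L by (simp add: finite_sub_effect_algebra_def)
  have \<rho>c: "\<rho> \<in> carrier_mat n n"
    using \<rho> by (simp add: positive_states_def density_ops_def)
  show ?thesis
  proof unfold_locales
    show "born \<rho> (ea_zero (matrix_ea n L)) = ea_zero unit_interval_ea"
      by (simp add: matrix_ea_def unit_interval_ea_def born_zero[OF \<rho>c])
    show "inj_on (born \<rho>) (ea_carrier (matrix_ea n L))"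
      using inj by (simp add: matrix_ea_def)
    fix A B s
    assume "ea_plus (matrix_ea n L) A B = Some s"
    then have mem: "A \<in> L" "B \<in> L" "s \<in> L" and s: "s = A + B"
      by (auto simp: matrix_ea_def split: if_splits)
    have "born \<rho> s = born \<rho> A + born \<rho> B"
      using mem eff \<rho>c unfolding s by (intro born_add[of _ n]) (auto simp: effects_def)
    then show "ea_plus unit_interval_ea (born \<rho> A) (born \<rho> B) = Some (born \<rho> s)"
      using born_in_unit_interval[OF \<rho>, of A] born_in_unit_interval[OF \<rho>, of B]
        born_in_unit_interval[OF \<rho>, of s] mem eff
      by (auto simp: unit_interval_ea_def)
  qed
qed

theorem mainTheorem5:
  fixes n :: nat
    and L :: "complex mat set"
    and X :: "'x set" and c :: "'x \<Rightarrow> 'x \<Rightarrow> complex mat"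
    and Y :: "'y set" and d :: "'y \<Rightarrow> 'y \<Rightarrow> complex mat"
    and x :: 'x and y :: 'y
  assumes "finite_sub_effect_algebra n L"
    and "coalgebra (matrix_ea n L) X c"
    and "coalgebra (matrix_ea n L) Y d"
    and "x \<in> X" and "y \<in> Y"
    and "\<And>\<rho>. \<rho> \<in> density_ops n \<Longrightarrow>
           kernel_bisimilar unit_interval_ea X (down_coalg \<rho> c) Y (down_coalg \<rho> d) x y"
  shows "kernel_bisimilar (matrix_ea n L) X c Y d x y"
proof (cases "n = 0")
  case True
  \<comment> \<open>There is no density operator in dimension 0, but then \<open>0 = \<I>\<close> is the only effect.\<close>
  have "L = {0\<^sub>m n n}"
    using assms(1) True by (auto simp: finite_sub_effect_algebra_def effects_def intro!: eq_matI)
  then show ?thesis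
    using assms(1-3)
    by (intro kernel_bisimilar_trivial) (auto simp: finite_sub_effect_algebra_def matrix_ea_def)
next
  case False
  then obtain \<rho> where \<rho>: "\<rho> \<in> positive_states n" "inj_on (born \<rho>) L"
    using born_inj_on_finite[of n L] assms(1) by (auto simp: finite_sub_effect_algebra_def)
  interpret effect_algebra_embedding "matrix_ea n L" unit_interval_ea "born \<rho>"
    using born_embedding[OF assms(1) \<rho>] .
  \<comment> \<open>The hypothesis is taken at the separating state, where \<open>down_coalg\<close>
    is composition with the embedding.\<close>
  have "kernel_bisimilar unit_interval_ea X (\<lambda>x. born \<rho> \<circ> c x) Y (\<lambda>y. born \<rho> \<circ> d y) x y"
    using assms(6)[of \<rho>] \<rho>(1) by (simp add: positive_states_def down_coalg_def[abs_def])
  then show ?thesis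
    by (rule kernel_bisimilar_reflect[OF assms(2,3)])
qed

end
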